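(* Let $G=(D,S,E)$ be a finite bipartite graph without isolated nodes, let $\lambda: D\to(0,\infty)$ and $\mu: S\to(0,\infty)$ be rate functions, and let $\boldsymbol{X}$ be the load balancing process associated with $G$, $\lambda$ and $\mu$. Fix constants $\lambda_0,\mu_0$ such that $$0<\lambda_0\le \min_{d\in D}\lambda(d),\qquad \max_{u\in S}\mu(u)\le \mu_0<\infty,$$ and let $\rho_0 = \lambda_0/\mu_0$. Suppose that $\boldsymbol{X}$ is ergodic and let $q$ be its steady-state occupancy. Then $$\mathbb{E}[q(i)] \ge \frac{[r(\rho_0,\alpha_G)]^i}{\alpha_G}\quad\text{for all } i\in\mathbb{N} \text{ with } i\ge \frac{1}{\rho_0},$$ where $r(\rho,x) = (\rho/x)^x$ and $$\alpha_G = \frac{1}{|S|}\sum_{u\in S}\min\{\deg(d): d\in\mathcal{N}(u)\}.$$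
   Context: Here $\mathbb{N}=\{0,1,2,\dots\}$. Networks. $D$ and $S$ are finite nonempty sets (dispatchers and servers) and $E\subset D\times S$; dispatcher $d$ can send tasks to server $u$ only if $(d,u)\in E$ (then $d$ and $u$ are called compatible). No isolated nodes means each dispatcher is compatible with at least one server and each server with at least one dispatcher. For $d\in D$, $\mathcal{N}(d)=\{u\in S:(d,u)\in E\}$ and $\deg(d)=|\mathcal{N}(d)|$; for $u\in S$, $\mathcal{N}(u)=\{d\in D:(d,u)\in E\}$. Load balancing process. Each dispatcher $d$ receives tasks as an independent Poisson process of intensity $\lambda(d)$ and sends each incoming task immediately to a compatible server with the shortest queue (fewest tasks, including any in service), ties broken uniformly at random. Each server $u$ executes its tasks sequentially, with independent exponentially distributed service times of rate $\mu(u)$. Let $\boldsymbol{X}(t,u)$ be the number of tasks at server $u$ at time $t$. Then $\boldsymbol{X}$ is a continuous-time Markov chain on $\mathbb{N}^S$ and is called the load balancing process associated with $G$, $\lambda$, $\mu$. Equivalently, from state $x\in\mathbb{N}^S$ the transition $x\to x+e_u$ has rate $\sum_{d\in\mathcal{N}(u)}\lambda(d)\,\mathbf{1}\{x(u)=\min_{v\in\mathcal{N}(d)}x(v)\}\,/\,|\{w\in\mathcal{N}(d):x(w)=\min_{v\in\mathcal{N}(d)}x(v)\}|$ and the transition $x\to x-e_u$ has rate $\mu(u)\mathbf{1}\{x(u)>0\}$, where $e_u$ is the unit vector of coordinate $u$. Steady-state occupancy. If $\boldsymbol{X}$ is ergodic (i.e., this irreducible chain is positive recurrent), let $X$ be a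 random vector with its unique stationary distribution. The steady-state occupancy is the random sequence $q(i)=\frac{1}{|S|}\sum_{u\in S}\mathbf{1}\{X(u)\ge i\}$, $i\in\mathbb{N}$. *)

theory Defs
  imports "HOL-Probability.Probability"
begin

section \<open>Continuous-time Markov chains\<close>

text \<open>
  A chain on a countable state space is a process \<open>X\<close> together with a family \<open>P\<close> of measures:
  \<open>P x\<close> is the probability measure under which the chain starts at \<open>x\<close>.
\<close>

definition transition_prob ::
  "('a \<Rightarrow> 'w measure) \<Rightarrow> (real \<Rightarrow> 'w \<Rightarrow> 'a) \<Rightarrow> real \<Rightarrow> 'a \<Rightarrow> 'a \<Rightarrow> real" where
  "transition_prob P X t x y = measure (P x) {\<omega> \<in> space (P x). X t \<omega> = y}"

text \<open>
  The last two conjuncts say that the off-diagonal entries of the generator are given by \<open>R\<close>, and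
  that its diagonal entries are minus the total exit rates, so that no mass is lost.  The Markov
  property is written in product form to avoid conditioning on null events.
\<close>

definition markov_chain_with_rates ::
  "('a::countable \<Rightarrow> 'a \<Rightarrow> real) \<Rightarrow> ('a \<Rightarrow> 'w measure) \<Rightarrow> (real \<Rightarrow> 'w \<Rightarrow> 'a) \<Rightarrow> bool" where
  "markov_chain_with_rates R P X \<longleftrightarrow>
     (\<forall>x. prob_space (P x)) \<and>
     (\<forall>x. \<forall>t\<ge>0. X t \<in> measurable (P x) (count_space UNIV)) \<and>
     (\<forall>x. AE \<omega> in P x. X 0 \<omega> = x) \<and>
     (\<forall>x. \<forall>\<omega>\<in>space (P x). \<forall>t\<ge>0. \<exists>\<epsilon>>0. \<forall>s\<in>{t..<t + \<epsilon>}. X s \<omega> = X t \<omega>) \<and>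
     (\<forall>x z h n. \<forall>\<tau> :: nat \<Rightarrow> real. \<forall>\<xi> :: nat \<Rightarrow> 'a.
        0 \<le> \<tau> 0 \<and> mono_on {..n} \<tau> \<and> 0 \<le> h \<longrightarrow>
        measure (P x) {\<omega> \<in> space (P x). (\<forall>k\<le>n. X (\<tau> k) \<omega> = \<xi> k) \<and> X (\<tau> n + h) \<omega> = z} =
        measure (P x) {\<omega> \<in> space (P x). \<forall>k\<le>n. X (\<tau> k) \<omega> = \<xi> k} * transition_prob P X h (\<xi> n) z) \<and>
     (\<forall>x y. x \<noteq> y \<longrightarrow> ((\<lambda>h. transition_prob P X h x y / h) \<longlongrightarrow> R x y) (at_right 0)) \<and>
     (\<forall>x. ((\<lambda>h. (1 - transition_prob P X h x x) / h) \<longlongrightarrow> (\<Sum>\<^sub>\<infinity>y\<in>- {x}. R x y)) (at_right 0))"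

definition irreducible_chain ::
  "('a \<Rightarrow> 'w measure) \<Rightarrow> (real \<Rightarrow> 'w \<Rightarrow> 'a) \<Rightarrow> bool" where
  "irreducible_chain P X \<longleftrightarrow> (\<forall>x y. \<exists>t\<ge>0. transition_prob P X t x y > 0)"

text \<open>
  The first time at which the path is at \<open>x\<close> after having been elsewhere;
  it is \<open>\<infinity>\<close> if there is no such time.
\<close>

definition return_time :: "(real \<Rightarrow> 'w \<Rightarrow> 'a) \<Rightarrow> 'a \<Rightarrow> 'w \<Rightarrow> ennreal" where
  "return_time X x \<omega> =
     Inf {ennreal t |t. 0 \<le> t \<and> X t \<omega> = x \<and> (\<exists>s\<in>{0..t}. X s \<omega> \<noteq> x)}"

definition positive_recurrent ::
  "('a \<Rightarrow> 'w measure) \<Rightarrow> (real \<Rightarrow> 'w \<Rightarrow> 'a) \<Rightarrow> bool" where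
  "positive_recurrent P X \<longleftrightarrow> (\<forall>x. (\<integral>\<^sup>+\<omega>. return_time X x \<omega> \<partial>P x) < \<infinity>)"

definition ergodic_chain ::
  "('a \<Rightarrow> 'w measure) \<Rightarrow> (real \<Rightarrow> 'w \<Rightarrow> 'a) \<Rightarrow> bool" where
  "ergodic_chain P X \<longleftrightarrow> irreducible_chain P X \<and> positive_recurrent P X"

definition stationary_distribution ::
  "('a \<Rightarrow> 'w measure) \<Rightarrow> (real \<Rightarrow> 'w \<Rightarrow> 'a) \<Rightarrow> 'a pmf \<Rightarrow> bool" where
  "stationary_distribution P X \<pi> \<longleftrightarrow>
     (\<forall>t\<ge>0. \<forall>y. measure_pmf.expectation \<pi> (\<lambda>x. transition_prob P X t x y) = pmf \<pi> y)"

section \<open>Load balancing on a bipartite graph\<close>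

text \<open>
  Dispatchers and servers are the elements of finite types \<open>'d\<close> and \<open>'s\<close>; a graph is its set of
  edges, and \<open>'s \<Rightarrow> nat\<close> is the state space.
\<close>

definition servers_of :: "('d \<times> 's) set \<Rightarrow> 'd \<Rightarrow> 's set" where
  "servers_of E d = {u. (d, u) \<in> E}"

definition dispatchers_of :: "('d \<times> 's) set \<Rightarrow> 's \<Rightarrow> 'd set" where
  "dispatchers_of E u = {d. (d, u) \<in> E}"

definition dispatcher_degree :: "('d \<times> 's) set \<Rightarrow> 'd \<Rightarrow> nat" where
  "dispatcher_degree E d = card (servers_of E d)"

definition no_isolated_nodes :: "('d \<times> 's) set \<Rightarrow> bool" where
  "no_isolated_nodes E \<longleftrightarrow> (\<forall>d. servers_of E d \<noteq> {}) \<and> (\<forall>u. dispatchers_of E u \<noteq> {})"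

definition shortest_queues :: "('d \<times> 's) set \<Rightarrow> ('s \<Rightarrow> nat) \<Rightarrow> 'd \<Rightarrow> 's set" where
  "shortest_queues E x d = {w \<in> servers_of E d. x w = Min (x ` servers_of E d)}"

definition arrival_rate ::
  "('d::finite \<times> 's::finite) set \<Rightarrow> ('d \<Rightarrow> real) \<Rightarrow> ('s \<Rightarrow> nat) \<Rightarrow> 's \<Rightarrow> real" where
  "arrival_rate E lam x u =
     (\<Sum>d\<in>dispatchers_of E u. lam d * of_bool (u \<in> shortest_queues E x d)
                                / real (card (shortest_queues E x d)))"

definition load_balancing_rate ::
  "('d::finite \<times> 's::finite) set \<Rightarrow> ('d \<Rightarrow> real) \<Rightarrow> ('s \<Rightarrow> real)
     \<Rightarrow> ('s \<Rightarrow> nat) \<Rightarrow> ('s \<Rightarrow> nat) \<Rightarrow> real" where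
  "load_balancing_rate E lam \<mu> x y =
     (\<Sum>u\<in>UNIV. of_bool (y = x(u := x u + 1)) * arrival_rate E lam x u
               + of_bool (x u > 0 \<and> y = x(u := x u - 1)) * \<mu> u)"

definition load_balancing_process ::
  "('d::finite \<times> 's::finite) set \<Rightarrow> ('d \<Rightarrow> real) \<Rightarrow> ('s \<Rightarrow> real)
     \<Rightarrow> (('s \<Rightarrow> nat) \<Rightarrow> 'w measure) \<Rightarrow> (real \<Rightarrow> 'w \<Rightarrow> 's \<Rightarrow> nat) \<Rightarrow> bool" where
  "load_balancing_process E lam \<mu> P X \<longleftrightarrow>
     markov_chain_with_rates (load_balancing_rate E lam \<mu>) P X"

definition occupancy :: "('s::finite \<Rightarrow> nat) \<Rightarrow> nat \<Rightarrow> real" where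
  "occupancy x i = (\<Sum>u\<in>UNIV. of_bool (x u \<ge> i)) / real CARD('s)"

definition graph_alpha :: "('d::finite \<times> 's::finite) set \<Rightarrow> real" where
  "graph_alpha E =
     (\<Sum>u\<in>UNIV. real (Min (dispatcher_degree E ` dispatchers_of E u))) / real CARD('s)"

definition r_fun :: "real \<Rightarrow> real \<Rightarrow> real" where
  "r_fun \<rho> x = (\<rho> / x) powr x"

end

theory Submission
  imports Defs
begin

text \<open>
  Fix a server \<open>u\<close> and a dispatcher \<open>d\<close> of degree \<open>k\<close> compatible with \<open>u\<close>.  Cutting off all other
  dispatchers, lowering the arrival rate of \<open>d\<close> to \<open>lam\<^sub>0\<close> and raising all service rates to \<open>\<mu>\<^sub>0\<close>
  can only shorten queues, because joining the shortest queue respects the coordinatewise order of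
  states.  In the resulting isolated system two things become easy.  The \<open>k\<close> servers of \<open>d\<close> are
  exchangeable, so each of them has at least \<open>i\<close> tasks with probability at least \<open>1 / k\<close> times the
  probability that some of them has; and the latter event occurs as soon as their total backlog is
  at least \<open>k * i\<close>.  The backlog goes up at rate \<open>lam\<^sub>0\<close> and down at rate at most \<open>k * \<mu>\<^sub>0\<close>, so it has
  a geometric tail of ratio at least \<open>\<rho>\<^sub>0 / k\<close>.  Hence server \<open>u\<close> has at least \<open>i\<close> tasks with
  probability at least \<open>r_fun \<rho>\<^sub>0 k ^ i / k\<close>.  This is a convex function of \<open>k\<close> on \<open>k \<ge> \<rho>\<^sub>0\<close>, a range
  that stationarity forces, and Jensen's inequality over the servers, with \<open>d\<close> of minimal degree
  for each \<open>u\<close>, gives the bound at the mean degree \<open>graph_alpha E\<close>.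

  The comparison is carried out with generators instead of a coupling of sample paths.  The rates of
  the chain are bounded, which turns stationarity for the transition probabilities into
  \<open>\<integral> L f d\<pi> = 0\<close> for every bounded \<open>f\<close>, where \<open>L\<close> is the generator (\<open>stationary_generator_zero\<close>).
  For increasing \<open>f\<close> the generator \<open>L'\<close> of the isolated system satisfies \<open>L' f \<le> L f\<close>
  (\<open>isolated_generator_le\<close>), and the uniformized operator \<open>I + \<epsilon> L'\<close> maps increasing functions to
  increasing functions (\<open>step_mono\<close>).  Iterating, the \<open>\<pi>\<close>-mean of an increasing \<open>f\<close> is at least
  \<open>(I + \<epsilon> L')^n f\<close> at the empty state, for every \<open>n\<close> (\<open>iterate_le_stationary\<close>).  These lower bounds
  increase with \<open>n\<close> when \<open>f\<close> is a tail event of the backlog, and their limits satisfy the cut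
  inequalities of a birth and death chain, from which the geometric tail follows
  (\<open>iterate_backlog_limit\<close>).  Both ingredients meet in \<open>server_tail_bound\<close>.
\<close>

section \<open>Stationarity in terms of transition rates\<close>

lemma transition_prob_return_ge:
  assumes mc: "markov_chain_with_rates R P X" and t: "t \<ge> 0" and s: "s \<ge> 0"
  shows "transition_prob P X t x x * transition_prob P X s x x \<le> transition_prob P X (t + s) x x"
proof -
  have ps: "prob_space (P x)" and meas: "\<And>t. t \<ge> 0 \<Longrightarrow> X t \<in> measurable (P x) (count_space UNIV)"
    using mc unfolding markov_chain_with_rates_def by blast+
  interpret prob_space "P x" by (rule ps)
  have mp: "\<And>x z h n. \<And>\<tau> :: nat \<Rightarrow> real. \<And>\<xi>.
        0 \<le> \<tau> 0 \<and> mono_on {..n} \<tau> \<and> 0 \<le> h \<Longrightarrow>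
        measure (P x) {\<omega> \<in> space (P x). (\<forall>k\<le>n. X (\<tau> k) \<omega> = \<xi> k) \<and> X (\<tau> n + h) \<omega> = z} =
        measure (P x) {\<omega> \<in> space (P x). \<forall>k\<le>n. X (\<tau> k) \<omega> = \<xi> k} * transition_prob P X h (\<xi> n) z"
    using mc unfolding markov_chain_with_rates_def by blast
  have "measure (P x) {\<omega> \<in> space (P x). X t \<omega> = x \<and> X (t + s) \<omega> = x}
      = transition_prob P X t x x * transition_prob P X s x x"
    using mp[of "\<lambda>_. t" 0 s x "\<lambda>_. x" x] t s
    by (simp add: transition_prob_def mono_on_def)
  moreover have "measure (P x) {\<omega> \<in> space (P x). X t \<omega> = x \<and> X (t + s) \<omega> = x}
      \<le> transition_prob P X (t + s) x x"
    unfolding transition_prob_def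
  proof (rule finite_measure_mono)
    have [measurable]: "X (t + s) \<in> measurable (P x) (count_space UNIV)"
      using meas t s by auto
    show "{\<omega> \<in> space (P x). X (t + s) \<omega> = x} \<in> events"
      by measurable
  qed auto
  ultimately show ?thesis by simp
qed

lemma transition_prob_nonneg: "0 \<le> transition_prob P X t x y"
  by (simp add: transition_prob_def)

lemma transition_prob_le_1:
  assumes "markov_chain_with_rates R P X"
  shows "transition_prob P X t x y \<le> 1"
  using assms unfolding markov_chain_with_rates_def transition_prob_def
  by (auto intro: prob_space.prob_le_1)

lemma transition_prob_0:
  assumes "markov_chain_with_rates R P X"
  shows "transition_prob P X 0 x x = 1"
proof -
  interpret prob_space "P x"
    using assms unfolding markov_chain_with_rates_def by blast
  have [measurable]: "X 0 \<in> measurable (P x) (count_space UNIV)"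
    and ae: "AE \<omega> in P x. X 0 \<omega> = x"
    using assms unfolding markov_chain_with_rates_def by (blast, blast)
  have "{\<omega> \<in> space (P x). X 0 \<omega> = x} \<in> events" by measurable
  then have "prob {\<omega> \<in> space (P x). X 0 \<omega> = x} = 1"
    using ae by (subst prob_Collect_eq_1) auto
  then show ?thesis by (simp add: transition_prob_def)
qed

lemma transition_prob_leave_le:
  assumes mc: "markov_chain_with_rates R P X" and t: "t \<ge> 0" and ne: "x \<noteq> y"
  shows "transition_prob P X t x y \<le> 1 - transition_prob P X t x x"
proof -
  interpret prob_space "P x"
    using mc unfolding markov_chain_with_rates_def by blast
  have [measurable]: "X t \<in> measurable (P x) (count_space UNIV)"
    using mc t unfolding markov_chain_with_rates_def by blast
  have ev: "{\<omega> \<in> space (P x). X t \<omega> = z} \<in> events" for z by measurable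
  have "prob ({\<omega> \<in> space (P x). X t \<omega> = x} \<union> {\<omega> \<in> space (P x). X t \<omega> = y})
      = transition_prob P X t x x + transition_prob P X t x y"
    unfolding transition_prob_def using ne
    by (intro finite_measure_Union ev) auto
  then show ?thesis
    using prob_le_1[of "{\<omega> \<in> space (P x). X t \<omega> = x} \<union> {\<omega> \<in> space (P x). X t \<omega> = y}"] by simp
qed

text \<open>
  The generator only controls this difference quotient as the time tends to 0.  Staying at \<open>x\<close> at the
  \<open>n\<close> multiples of \<open>h / n\<close> is one way to be at \<open>x\<close> at time \<open>h\<close>, so the return probability at \<open>h\<close> is at
  least the \<open>n\<close>-th power of the one at \<open>h / n\<close>; Bernoulli's inequality makes this a bound by the
  difference quotient at \<open>h / n\<close>, and \<open>n\<close> tends to infinity.  Uniformity in \<open>h\<close> is what dominated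
  convergence needs below.
\<close>

lemma exit_prob_le_exit_rate:
  assumes mc: "markov_chain_with_rates R P X" and h: "h > 0"
  shows "1 - transition_prob P X h x x \<le> h * (\<Sum>\<^sub>\<infinity>y\<in>- {x}. R x y)"
proof -
  let ?p = "\<lambda>t. transition_prob P X t x x"
  have pow: "?p t ^ n \<le> ?p (real n * t)" if "t \<ge> 0" for t n
  proof (induction n)
    case 0
    then show ?case using transition_prob_0[OF mc] by simp
  next
    case (Suc n)
    have "?p t ^ Suc n \<le> ?p (real n * t) * ?p t"
      using Suc by (simp add: mult.commute mult_left_mono transition_prob_nonneg)
    also have "\<dots> \<le> ?p (real n * t + t)"
      using that by (intro transition_prob_return_ge[OF mc]) auto
    finally show ?case by (simp add: algebra_simps)
  qed
  have bound: "1 - ?p h \<le> h * ((1 - ?p (h / real (Suc n))) / (h / real (Suc n)))" for n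
  proof -
    let ?q = "?p (h / real (Suc n))"
    have "1 + real (Suc n) * (?q - 1) \<le> (1 + (?q - 1)) ^ Suc n"
      by (rule Bernoulli_inequality) (simp add: transition_prob_nonneg)
    also have "\<dots> \<le> ?p h"
      using pow[of "h / real (Suc n)" "Suc n"] h by simp
    finally have "1 - ?p h \<le> real (Suc n) * (1 - ?q)"
      by (simp add: algebra_simps)
    moreover have "h * ((1 - ?q) / (h / real (Suc n))) = real (Suc n) * (1 - ?q)"
      using h by simp
    ultimately show ?thesis by simp
  qed
  have deriv: "((\<lambda>h. (1 - ?p h) / h) \<longlongrightarrow> (\<Sum>\<^sub>\<infinity>y\<in>- {x}. R x y)) (at_right 0)"
    using mc unfolding markov_chain_with_rates_def by blast
  have "filterlim (\<lambda>n. h / real (Suc n)) (at_right 0) sequentially"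
    unfolding filterlim_at
  proof (intro conjI)
    show "(\<lambda>n. h / real (Suc n)) \<longlonglongrightarrow> 0"
      using tendsto_mult_right_zero[OF lim_inverse_n', of h] 
      by (intro LIMSEQ_Suc[where f = "\<lambda>n. h / real n"]) (simp add: divide_inverse)
    show "\<forall>\<^sub>F n in sequentially. h / real (Suc n) \<in> {0<..} \<and> h / real (Suc n) \<noteq> 0"
      using h by (auto intro!: always_eventually)
  qed
  from tendsto_mult[OF tendsto_const filterlim_compose[OF deriv this], of h]
  show ?thesis
    by (rule LIMSEQ_le_const) (use bound in blast)
qed

text \<open>
  Global balance: differentiate the stationarity equation for \<open>y\<close> at time 0.  Bounded exit rates
  dominate all difference quotients, so the limit may be taken inside the expectation.
\<close>

lemma stationary_balance:
  assumes mc: "markov_chain_with_rates R P X"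
    and st: "stationary_distribution P X \<pi>"
    and exit: "\<And>x. (\<Sum>\<^sub>\<infinity>y\<in>- {x}. R x y) \<le> \<Lambda>"
  shows "measure_pmf.expectation \<pi> (\<lambda>x. of_bool (x \<noteq> y) * R x y)
       = pmf \<pi> y * (\<Sum>\<^sub>\<infinity>z\<in>- {y}. R y z)"
proof -
  let ?p = "transition_prob P X"
  define h where "h n = inverse (real (Suc n))" for n
  have hpos: "h n > 0" for n by (simp add: h_def)
  have lim: "filterlim h (at_right 0) sequentially"
    unfolding filterlim_at
  proof (intro conjI)
    show "h \<longlonglongrightarrow> 0" unfolding h_def by (rule LIMSEQ_inverse_real_of_nat)
    show "\<forall>\<^sub>F n in sequentially. h n \<in> {0<..} \<and> h n \<noteq> 0"
      using hpos by (auto intro!: always_eventually simp: less_imp_neq[symmetric])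
  qed
  have off: "((\<lambda>h. ?p h x y / h) \<longlongrightarrow> R x y) (at_right 0)" if "x \<noteq> y" for x
    using mc that unfolding markov_chain_with_rates_def by blast
  have diag: "((\<lambda>h. (1 - ?p h y y) / h) \<longlongrightarrow> (\<Sum>\<^sub>\<infinity>z\<in>- {y}. R y z)) (at_right 0)"
    using mc unfolding markov_chain_with_rates_def by blast
  \<comment> \<open>Off-diagonal part of the stationarity equation, divided by the time step; the diagonal part is
     moved to the other side, where it becomes the exit probability from \<open>y\<close>.\<close>
  let ?F = "\<lambda>n x. of_bool (x \<noteq> y) * (?p (h n) x y / h n)"
  have "(\<lambda>n. measure_pmf.expectation \<pi> (?F n)) \<longlonglongrightarrow>
      measure_pmf.expectation \<pi> (\<lambda>x. of_bool (x \<noteq> y) * R x y)"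
  proof (rule integral_dominated_convergence[where w = "\<lambda>_. \<bar>\<Lambda>\<bar>"])
    show "AE x in measure_pmf \<pi>. (\<lambda>n. ?F n x) \<longlonglongrightarrow> of_bool (x \<noteq> y) * R x y"
      using filterlim_compose[OF off lim] by (intro always_eventually) auto
    show "AE x in measure_pmf \<pi>. norm (?F n x) \<le> \<bar>\<Lambda>\<bar>" for n
    proof (intro always_eventually allI)
      fix x
      show "norm (?F n x) \<le> \<bar>\<Lambda>\<bar>"
      proof (cases "x = y")
        case False
        have "?p (h n) x y \<le> 1 - ?p (h n) x x"
          using transition_prob_leave_le[OF mc _ False] hpos[of n] by simp
        also have "\<dots> \<le> h n * (\<Sum>\<^sub>\<infinity>y\<in>- {x}. R x y)"
          by (rule exit_prob_le_exit_rate[OF mc hpos])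
        also have "\<dots> \<le> h n * \<bar>\<Lambda>\<bar>"
          using exit[of x] hpos[of n] by (intro mult_left_mono) auto
        finally have "?p (h n) x y / h n \<le> \<bar>\<Lambda>\<bar>"
          using hpos[of n] by (simp add: field_simps)
        then show ?thesis
          using False hpos[of n] by (simp add: transition_prob_nonneg)
      qed simp
    qed
  qed auto
  moreover have "measure_pmf.expectation \<pi> (?F n) = pmf \<pi> y * ((1 - ?p (h n) y y) / h n)" for n
  proof -
    have int: "integrable (measure_pmf \<pi>) (\<lambda>x. ?p (h n) x y)"
      by (rule measure_pmf.integrable_const_bound[where B = 1])
        (auto simp: transition_prob_nonneg transition_prob_le_1[OF mc])
    have int': "integrable (measure_pmf \<pi>) (\<lambda>x. of_bool (x = y) * ?p (h n) y y)"
      by (rule measure_pmf.integrable_const_bound[where B = 1])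
        (auto simp: transition_prob_nonneg transition_prob_le_1[OF mc])
    have at: "measure_pmf.expectation \<pi> (\<lambda>x. of_bool (x = y) * ?p (h n) y y) = pmf \<pi> y * ?p (h n) y y"
      by (subst integral_measure_pmf[of "{y}"]) auto
    have "?F n = (\<lambda>x. (?p (h n) x y - of_bool (x = y) * ?p (h n) y y) / h n)"
      by auto
    then have "measure_pmf.expectation \<pi> (?F n)
        = (measure_pmf.expectation \<pi> (\<lambda>x. ?p (h n) x y)
            - measure_pmf.expectation \<pi> (\<lambda>x. of_bool (x = y) * ?p (h n) y y)) / h n"
      using int int' by simp
    also have "\<dots> = (pmf \<pi> y - pmf \<pi> y * ?p (h n) y y) / h n"
      using st hpos[of n] at unfolding stationary_distribution_def by simp
    finally show ?thesis by (simp add: algebra_simps diff_divide_distrib)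
  qed
  moreover have "(\<lambda>n. pmf \<pi> y * ((1 - ?p (h n) y y) / h n)) \<longlonglongrightarrow> pmf \<pi> y * (\<Sum>\<^sub>\<infinity>z\<in>- {y}. R y z)"
    by (intro tendsto_mult tendsto_const filterlim_compose[OF diag lim])
  ultimately show ?thesis
    by (simp only:) (rule LIMSEQ_unique)
qed

section \<open>The generator of the load balancing process\<close>

text \<open>
  The departure term carries no indicator of a busy server: with truncated subtraction an idle server
  contributes a difference \<open>f x - f x = 0\<close>.
\<close>

definition load_balancing_generator ::
  "('d::finite \<times> 's::finite) set \<Rightarrow> ('d \<Rightarrow> real) \<Rightarrow> ('s \<Rightarrow> real)
     \<Rightarrow> (('s \<Rightarrow> nat) \<Rightarrow> real) \<Rightarrow> ('s \<Rightarrow> nat) \<Rightarrow> real" where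
  "load_balancing_generator E lam \<mu> f x =
     (\<Sum>u\<in>UNIV. arrival_rate E lam x u * (f (x(u := x u + 1)) - f x))
     + (\<Sum>u\<in>UNIV. \<mu> u * (f (x(u := x u - 1)) - f x))"

lemma arrival_rate_nonneg:
  assumes "\<And>d. lam d \<ge> 0"
  shows "0 \<le> arrival_rate E lam x u"
  unfolding arrival_rate_def using assms by (intro sum_nonneg) simp

lemma arrival_rate_le:
  assumes "\<And>d. lam d \<ge> 0"
  shows "arrival_rate E lam x u \<le> (\<Sum>d\<in>UNIV. lam d)"
proof -
  have "lam d * of_bool (u \<in> shortest_queues E x d) / real (card (shortest_queues E x d)) \<le> lam d" for d
  proof (cases "u \<in> shortest_queues E x d")
    case True
    then have "card (shortest_queues E x d) \<ge> 1"
      by (metis One_nat_def Suc_leI card_gt_0_iff empty_iff finite)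
    then have "1 \<le> real (card (shortest_queues E x d))"
      by linarith
    then show ?thesis
      using assms[of d] True by (simp add: divide_le_eq mult_le_cancel_left1)
  qed (use assms in auto)
  then have "arrival_rate E lam x u \<le> (\<Sum>d\<in>dispatchers_of E u. lam d)"
    unfolding arrival_rate_def by (intro sum_mono)
  also have "\<dots> \<le> (\<Sum>d\<in>UNIV. lam d)"
    using assms by (intro sum_mono2) auto
  finally show ?thesis .
qed

lemma fun_upd_self_iff: "x(u := c) = x \<longleftrightarrow> c = x u"
  by (metis fun_upd_same fun_upd_triv)

lemma has_sum_finite_sum:
  fixes f :: "'i \<Rightarrow> 'a \<Rightarrow> real"
  assumes "finite I" and "\<And>i. i \<in> I \<Longrightarrow> (f i has_sum c i) A"
  shows "((\<lambda>x. \<Sum>i\<in>I. f i x) has_sum (\<Sum>i\<in>I. c i)) A"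
  using assms by (induction I) (auto intro: has_sum_add)

lemma load_balancing_exit_rate:
  "(\<Sum>\<^sub>\<infinity>y\<in>- {x}. load_balancing_rate E lam \<mu> x y) =
    (\<Sum>u\<in>UNIV. arrival_rate E lam x u + of_bool (x u > 0) * \<mu> u)"
proof (rule infsumI)
  have point: "((\<lambda>y. of_bool (y = z) * c) has_sum c) (- {x})" if "z \<noteq> x" for z and c :: real
    using that by (intro has_sum_finite_neutralI[of "{z}"]) auto
  have dep: "((\<lambda>y. of_bool (x u > 0 \<and> y = x(u := x u - 1)) * \<mu> u) has_sum of_bool (x u > 0) * \<mu> u) (- {x})"
    for u
    using point[of "x(u := x u - 1)" "\<mu> u"]
    by (cases "x u > 0") (auto simp: fun_upd_self_iff)
  show "(load_balancing_rate E lam \<mu> x has_sum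
      (\<Sum>u\<in>UNIV. arrival_rate E lam x u + of_bool (x u > 0) * \<mu> u)) (- {x})"
    unfolding load_balancing_rate_def
    by (intro has_sum_finite_sum has_sum_add point dep) (auto simp: fun_upd_self_iff)
qed

lemma load_balancing_generator_point_mass:
  "load_balancing_generator E lam \<mu> (\<lambda>z. of_bool (z = y)) x =
     of_bool (x \<noteq> y) * load_balancing_rate E lam \<mu> x y
     - of_bool (x = y) * (\<Sum>\<^sub>\<infinity>z\<in>- {y}. load_balancing_rate E lam \<mu> y z)"
proof (cases "x = y")
  case True
  have "\<mu> u * (of_bool (y(u := y u - 1) = y) - 1) = - (of_bool (y u > 0) * \<mu> u)" for u
    by (auto simp: fun_upd_self_iff)
  then show ?thesis
    using True unfolding load_balancing_generator_def load_balancing_exit_rate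
    by (simp add: fun_upd_self_iff sum.distrib sum_negf)
next
  case False
  have "\<mu> u * of_bool (x(u := x u - 1) = y) = of_bool (x u > 0 \<and> y = x(u := x u - 1)) * \<mu> u" for u
    using False by auto
  moreover have "arrival_rate E lam x u * of_bool (x(u := x u + 1) = y)
      = of_bool (y = x(u := x u + 1)) * arrival_rate E lam x u" for u
    by auto
  ultimately show ?thesis
    using False unfolding load_balancing_generator_def load_balancing_rate_def sum.distrib
    by (simp only: of_bool_eq mult_1 mult_zero_left diff_zero simp_thms if_False if_True)
qed

lemma load_balancing_generator_sum:
  "load_balancing_generator E lam \<mu> (\<lambda>x. \<Sum>i\<in>A. c i * f i x) x
    = (\<Sum>i\<in>A. c i * load_balancing_generator E lam \<mu> (f i) x)"
proof -
  have "r * ((\<Sum>i\<in>A. c i * f i a) - (\<Sum>i\<in>A. c i * f i b)) = (\<Sum>i\<in>A. c i * (r * (f i a - f i b)))"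
    for r a b
    by (simp add: sum_subtractf[symmetric] sum_distrib_left algebra_simps)
  then have "load_balancing_generator E lam \<mu> (\<lambda>x. \<Sum>i\<in>A. c i * f i x) x
    = (\<Sum>u\<in>UNIV. \<Sum>i\<in>A. c i * (arrival_rate E lam x u * (f i (x(u := x u + 1)) - f i x)))
    + (\<Sum>u\<in>UNIV. \<Sum>i\<in>A. c i * (\<mu> u * (f i (x(u := x u - 1)) - f i x)))"
    unfolding load_balancing_generator_def by simp
  also have "\<dots> = (\<Sum>i\<in>A. c i * load_balancing_generator E lam \<mu> (f i) x)"
    unfolding load_balancing_generator_def
    by (subst (1 2) sum.swap) (simp add: sum_distrib_left sum.distrib distrib_left)
  finally show ?thesis .
qed

text \<open>
  A crude bound, but uniform in \<open>x\<close>: the generator is a bounded operator, so dominated convergence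
  and integrability under any law come for free.
\<close>

lemma load_balancing_generator_bounded:
  fixes E :: "('d::finite \<times> 's::finite) set"
  assumes lam: "\<And>d. lam d \<ge> 0" and mu: "\<And>u. \<mu> u \<ge> 0" and f: "\<And>x. \<bar>f x\<bar> \<le> B"
  shows "\<bar>load_balancing_generator E lam \<mu> f x\<bar>
    \<le> (\<Sum>u\<in>(UNIV::'s set). (\<Sum>d\<in>UNIV. lam d) * (2 * B)) + (\<Sum>u\<in>UNIV. \<mu> u * (2 * B))"
proof -
  have diff: "\<bar>f a - f b\<bar> \<le> 2 * B" for a b
    using f[of a] f[of b] by linarith
  have "\<bar>arrival_rate E lam x u * (f (x(u := x u + 1)) - f x)\<bar> \<le> (\<Sum>d\<in>UNIV. lam d) * (2 * B)" for u
    unfolding abs_mult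
    using arrival_rate_nonneg[of lam E x u, OF lam] arrival_rate_le[of lam E x u, OF lam] lam
    by (intro mult_mono diff) (auto intro: sum_nonneg)
  moreover have "\<bar>\<mu> u * (f (x(u := x u - 1)) - f x)\<bar> \<le> \<mu> u * (2 * B)" for u
    unfolding abs_mult using mu[of u] by (simp add: mult_left_mono diff)
  ultimately show ?thesis
    unfolding load_balancing_generator_def
    by (intro order_trans[OF abs_triangle_ineq] add_mono order_trans[OF sum_abs] sum_mono) auto
qed

lemma finite_total_le: "finite {x :: 's::finite \<Rightarrow> nat. (\<Sum>u\<in>UNIV. x u) \<le> n}"
proof (rule finite_subset)
  show "{x :: 's \<Rightarrow> nat. (\<Sum>u\<in>UNIV. x u) \<le> n} \<subseteq> PiE UNIV (\<lambda>_. {..n})"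
  proof (rule subsetI)
    fix x :: "'s \<Rightarrow> nat"
    assume "x \<in> {x. (\<Sum>u\<in>UNIV. x u) \<le> n}"
    then have "x u \<le> n" for u
      using member_le_sum[of u UNIV x] by simp
    then show "x \<in> PiE UNIV (\<lambda>_. {..n})" by auto
  qed
qed (simp add: finite_PiE)

text \<open>
  For point masses this is global balance, hence it holds for finitely supported functions by
  linearity.  A bounded \<open>f\<close> is the pointwise limit of its restrictions to states with at most \<open>n\<close>
  tasks, and the generator is continuous under bounded pointwise convergence because it is a finite
  sum of differences.
\<close>

lemma stationary_generator_zero:
  fixes E :: "('d::finite \<times> 's::finite) set"
  assumes lam: "\<And>d. lam d \<ge> 0" and mu: "\<And>u. \<mu> u \<ge> 0"
    and proc: "load_balancing_process E lam \<mu> P X"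
    and st: "stationary_distribution P X \<pi>"
    and f: "\<And>x. \<bar>f x\<bar> \<le> B"
  shows "measure_pmf.expectation \<pi> (load_balancing_generator E lam \<mu> f) = 0"
proof -
  let ?L = "load_balancing_generator E lam \<mu>"
  let ?R = "load_balancing_rate E lam \<mu>"
  have mc: "markov_chain_with_rates ?R P X"
    using proc unfolding load_balancing_process_def .
  have exit: "(\<Sum>\<^sub>\<infinity>y\<in>- {x}. ?R x y) \<le> (\<Sum>u\<in>(UNIV::'s set). (\<Sum>d\<in>UNIV. lam d) + \<mu> u)" for x
    unfolding load_balancing_exit_rate
    by (intro sum_mono add_mono arrival_rate_le lam) (simp add: mu)
  define K where "K B = (\<Sum>u\<in>(UNIV::'s set). (\<Sum>d\<in>UNIV. lam d) * (2 * B)) + (\<Sum>u\<in>UNIV. \<mu> u * (2 * B))"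
    for B
  have K: "\<bar>?L g x\<bar> \<le> K B" if "\<And>x. \<bar>g x\<bar> \<le> B" for g B x
    unfolding K_def by (rule load_balancing_generator_bounded[OF lam mu that])
  have int: "integrable (measure_pmf \<pi>) (?L g)" if "\<And>x. \<bar>g x\<bar> \<le> B" for g B
    by (rule measure_pmf.integrable_const_bound[where B = "K B"]) (use K[OF that] in auto)
  have point: "measure_pmf.expectation \<pi> (?L (\<lambda>z. of_bool (z = y))) = 0" for y
  proof -
    have i: "integrable (measure_pmf \<pi>) (\<lambda>x. of_bool (x = y) * (\<Sum>\<^sub>\<infinity>z\<in>- {y}. ?R y z))"
      by (rule measure_pmf.integrable_const_bound[where B = "\<bar>\<Sum>\<^sub>\<infinity>z\<in>- {y}. ?R y z\<bar>"]) auto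
    have i': "integrable (measure_pmf \<pi>) (?L (\<lambda>z. of_bool (z = y)))"
      by (rule int[where B = 1]) simp
    have eq: "of_bool (x \<noteq> y) * ?R x y
        = ?L (\<lambda>z. of_bool (z = y)) x + of_bool (x = y) * (\<Sum>\<^sub>\<infinity>z\<in>- {y}. ?R y z)" for x
      unfolding load_balancing_generator_point_mass by simp
    have "measure_pmf.expectation \<pi> (\<lambda>x. of_bool (x \<noteq> y) * ?R x y)
        = measure_pmf.expectation \<pi> (?L (\<lambda>z. of_bool (z = y)))
          + measure_pmf.expectation \<pi> (\<lambda>x. of_bool (x = y) * (\<Sum>\<^sub>\<infinity>z\<in>- {y}. ?R y z))"
      unfolding eq by (rule Bochner_Integration.integral_add[OF i' i])
    moreover have "measure_pmf.expectation \<pi> (\<lambda>x. of_bool (x = y) * (\<Sum>\<^sub>\<infinity>z\<in>- {y}. ?R y z))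
        = pmf \<pi> y * (\<Sum>\<^sub>\<infinity>z\<in>- {y}. ?R y z)"
      by (subst integral_measure_pmf[of "{y}"]) auto
    ultimately show ?thesis
      using stationary_balance[OF mc st exit, of y] by simp
  qed
  define A where "A n = {x :: 's \<Rightarrow> nat. (\<Sum>u\<in>UNIV. x u) \<le> n}" for n
  define g where "g n x = of_bool (x \<in> A n) * f x" for n x
  have g_bound: "\<bar>g n x\<bar> \<le> B" for n x
    using f[of x] by (auto simp: g_def)
  have g_sum: "g n = (\<lambda>x. \<Sum>y\<in>A n. f y * of_bool (x = y))" for n
  proof
    fix x
    have "finite (A n)"
      unfolding A_def by (rule finite_total_le)
    then have "(\<Sum>y\<in>A n. if x = y then f y else 0) = (if x \<in> A n then f x else 0)"
      by (rule sum.delta')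
    moreover have "f y * of_bool (x = y) = (if x = y then f y else 0)" for y
      by simp
    ultimately show "g n x = (\<Sum>y\<in>A n. f y * of_bool (x = y))"
      by (simp only: g_def) simp
  qed
  have zero: "measure_pmf.expectation \<pi> (?L (g n)) = 0" for n
  proof -
    have "?L (g n) = (\<lambda>x. \<Sum>y\<in>A n. f y * ?L (\<lambda>z. of_bool (z = y)) x)"
      unfolding g_sum load_balancing_generator_sum ..
    then have "measure_pmf.expectation \<pi> (?L (g n))
        = (\<Sum>y\<in>A n. f y * measure_pmf.expectation \<pi> (?L (\<lambda>z. of_bool (z = y))))"
      by (subst \<open>?L (g n) = _\<close>, subst Bochner_Integration.integral_sum)
        (auto intro!: int[where B = 1])
    then show ?thesis by (simp add: point)
  qed
  have g_lim: "(\<lambda>n. g n x) \<longlonglongrightarrow> f x" for x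
  proof (rule tendsto_eventually)
    show "\<forall>\<^sub>F n in sequentially. g n x = f x"
      using eventually_ge_at_top[of "\<Sum>u\<in>UNIV. x u"]
      by eventually_elim (simp add: g_def A_def)
  qed
  have "(\<lambda>n. measure_pmf.expectation \<pi> (?L (g n))) \<longlonglongrightarrow> measure_pmf.expectation \<pi> (?L f)"
  proof (rule integral_dominated_convergence[where w = "\<lambda>_. K B"])
    show "AE x in measure_pmf \<pi>. (\<lambda>n. ?L (g n) x) \<longlonglongrightarrow> ?L f x"
      unfolding load_balancing_generator_def
      by (intro always_eventually allI tendsto_intros g_lim)
    show "AE x in measure_pmf \<pi>. norm (?L (g n) x) \<le> K B" for n
      using K[OF g_bound] by simp
  qed auto
  then show ?thesis
    unfolding zero by (simp add: LIMSEQ_const_iff)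
qed

section \<open>Joining the shortest queue\<close>

definition shortest_in :: "'s set \<Rightarrow> ('s::finite \<Rightarrow> nat) \<Rightarrow> 's set" where
  "shortest_in M x = {w \<in> M. x w = Min (x ` M)}"

lemma shortest_in_nonempty:
  assumes "M \<noteq> {}"
  shows "shortest_in M x \<noteq> {}"
proof -
  have "Min (x ` M) \<in> x ` M"
    using assms by (intro Min_in) auto
  then show ?thesis
    unfolding shortest_in_def by force
qed

definition join_shortest :: "'s set \<Rightarrow> (('s::finite \<Rightarrow> nat) \<Rightarrow> real) \<Rightarrow> ('s \<Rightarrow> nat) \<Rightarrow> real" where
  "join_shortest M f x =
     (\<Sum>w\<in>shortest_in M x. f (x(w := x w + 1))) / real (card (shortest_in M x))"

lemma join_shortest_ge:
  assumes "mono f" and "M \<noteq> {}"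
  shows "f x \<le> join_shortest M f x"
proof -
  have c: "real (card (shortest_in M x)) > 0"
    using shortest_in_nonempty[OF assms(2), of x] by (simp add: card_gt_0_iff)
  have "f x \<le> f (x(w := x w + 1))" for w
    by (rule monoD[OF assms(1)]) (auto simp: le_fun_def)
  then have "(\<Sum>w\<in>shortest_in M x. f x) \<le> (\<Sum>w\<in>shortest_in M x. f (x(w := x w + 1)))"
    by (intro sum_mono)
  then show ?thesis
    using c unfolding join_shortest_def by (simp add: pos_le_divide_eq mult.commute)
qed

text \<open>
  Order preservation of the join-the-shortest-queue rule, the heart of the comparison.  If the minimum
  of \<open>x\<close> over \<open>M\<close> is smaller than that of \<open>y\<close>, a task added to a shortest queue of \<open>x\<close> still leaves a state
  below \<open>y\<close>.  If the minima agree, every shortest queue of \<open>y\<close> is also shortest in \<open>x\<close>; those common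
  queues are compared with each other, and at a queue that is shortest only in \<open>x\<close> there is room for
  one more task below \<open>y\<close>.  Uniform tie breaking causes no loss because \<open>x\<close> has at least as many ties.
\<close>

lemma join_shortest_mono:
  assumes f: "mono f" and M: "M \<noteq> {}" and xy: "x \<le> y"
  shows "join_shortest M f x \<le> join_shortest M f y"
proof -
  let ?A = "shortest_in M x" and ?B = "shortest_in M y"
  have A: "real (card ?A) > 0" and B: "real (card ?B) > 0"
    using shortest_in_nonempty[OF M] by (auto simp: card_gt_0_iff)
  have xy': "x w \<le> y w" for w using xy by (simp add: le_fun_def)
  have min_le: "Min (x ` M) \<le> x w" "Min (y ` M) \<le> y w" if "w \<in> M" for w
    using that by auto
  have at_A: "x w = Min (x ` M)" "w \<in> M" if "w \<in> ?A" for w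
    using that by (auto simp: shortest_in_def)
  have at_B: "y w = Min (y ` M)" "w \<in> M" if "w \<in> ?B" for w
    using that by (auto simp: shortest_in_def)
  have bump: "f (x(w := x w + 1)) \<le> f y" if "x w < y w" for w
    by (rule monoD[OF f]) (use that xy' in \<open>auto simp: le_fun_def\<close>)
  obtain w\<^sub>0 where w0: "w\<^sub>0 \<in> ?B" using shortest_in_nonempty[OF M] by blast
  have min_mono: "Min (x ` M) \<le> Min (y ` M)"
    using min_le(1)[OF at_B(2)[OF w0]] xy'[of w\<^sub>0] at_B(1)[OF w0] by linarith
  show ?thesis
  proof (cases "Min (x ` M) = Min (y ` M)")
    case False
    then have "x w < y w" if "w \<in> ?A" for w
      using min_mono at_A[OF that] min_le(2)[OF at_A(2)[OF that]] by linarith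
    then have "(\<Sum>w\<in>?A. f (x(w := x w + 1))) \<le> (\<Sum>w\<in>?A. f y)"
      by (intro sum_mono bump) auto
    then have "join_shortest M f x \<le> f y"
      using A unfolding join_shortest_def by (simp add: pos_divide_le_eq mult.commute)
    also have "\<dots> \<le> join_shortest M f y"
      by (rule join_shortest_ge[OF f M])
    finally show ?thesis .
  next
    case True
    have sub: "?B \<subseteq> ?A"
    proof
      fix w assume w: "w \<in> ?B"
      have "x w = Min (x ` M)"
        using at_B[OF w] xy'[of w] min_le(1)[of w] True by linarith
      then show "w \<in> ?A" using at_B[OF w] by (simp add: shortest_in_def)
    qed
    have "f (x(w := x w + 1)) \<le> f y" if "w \<in> ?A - ?B" for w
    proof (rule bump)
      have "w \<in> M" "y w \<noteq> Min (y ` M)" "x w = Min (x ` M)"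
        using that by (auto simp: shortest_in_def)
      then show "x w < y w" using True min_le(2)[of w] by linarith
    qed
    then have "(\<Sum>w\<in>?A - ?B. f (x(w := x w + 1))) \<le> (\<Sum>w\<in>?A - ?B. f y)"
      by (intro sum_mono) auto
    moreover have "f (x(w := x w + 1)) \<le> f (y(w := y w + 1))" for w
      by (rule monoD[OF f]) (use xy' in \<open>auto simp: le_fun_def\<close>)
    then have "(\<Sum>w\<in>?B. f (x(w := x w + 1))) \<le> (\<Sum>w\<in>?B. f (y(w := y w + 1)))"
      by (intro sum_mono) auto
    ultimately have "(\<Sum>w\<in>?A. f (x(w := x w + 1)))
        \<le> (\<Sum>w\<in>?B. f (y(w := y w + 1))) + real (card (?A - ?B)) * f y"
      using sum.subset_diff[OF sub, of "\<lambda>w. f (x(w := x w + 1))"] by simp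
    also have "\<dots> = real (card ?B) * join_shortest M f y + real (card (?A - ?B)) * f y"
      using B by (simp add: join_shortest_def)
    also have "\<dots> \<le> real (card ?B) * join_shortest M f y + real (card (?A - ?B)) * join_shortest M f y"
      by (intro add_left_mono mult_left_mono join_shortest_ge[OF f M]) simp
    also have "\<dots> = real (card ?A) * join_shortest M f y"
      using card_mono[OF _ sub] by (simp add: card_Diff_subset[OF _ sub] of_nat_diff algebra_simps)
    finally show ?thesis
      using A unfolding join_shortest_def[of M f x] by (simp add: pos_divide_le_eq mult.commute)
  qed
qed

lemma join_shortest_mono_fun:
  assumes "\<And>x. f x \<le> g x"
  shows "join_shortest M f x \<le> join_shortest M g x"
  unfolding join_shortest_def by (intro divide_right_mono sum_mono assms) simp

lemma join_shortest_linear: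
  "join_shortest M (\<lambda>x. c * f x + d * g x) x = c * join_shortest M f x + d * join_shortest M g x"
  by (simp add: join_shortest_def sum.distrib sum_distrib_left add_divide_distrib)

lemma join_shortest_const:
  assumes "M \<noteq> {}"
  shows "join_shortest M (\<lambda>x. c) x = c"
  using shortest_in_nonempty[OF assms, of x] by (simp add: join_shortest_def)

lemma fun_upd_comp_bij:
  assumes "bij \<sigma>"
  shows "(x \<circ> \<sigma>)(w := c) = (x(\<sigma> w := c)) \<circ> \<sigma>"
  using bij_is_inj[OF assms] by (auto simp: fun_eq_iff inj_eq)

lemma join_shortest_relabel:
  assumes \<sigma>: "bij \<sigma>" "\<sigma> ` M = M"
  shows "join_shortest M (\<lambda>x. f (x \<circ> \<sigma>)) x = join_shortest M f (x \<circ> \<sigma>)"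
proof -
  have "(x \<circ> \<sigma>) ` M = x ` M"
    using \<sigma>(2) by (metis image_comp)
  then have im: "\<sigma> ` shortest_in M (x \<circ> \<sigma>) = shortest_in M x"
    using \<sigma>(2) unfolding shortest_in_def by (auto simp: image_iff)
  have inj: "inj_on \<sigma> A" for A
    using bij_is_inj[OF \<sigma>(1)] by (rule inj_on_subset) simp
  have "(\<Sum>w\<in>shortest_in M (x \<circ> \<sigma>). f ((x \<circ> \<sigma>)(w := (x \<circ> \<sigma>) w + 1)))
      = (\<Sum>w\<in>shortest_in M x. f (x(w := x w + 1) \<circ> \<sigma>))"
    unfolding im[symmetric] by (simp add: sum.reindex[OF inj] fun_upd_comp_bij[OF \<sigma>(1)])
  moreover have "card (shortest_in M (x \<circ> \<sigma>)) = card (shortest_in M x)"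
    unfolding im[symmetric] by (simp add: card_image[OF inj])
  ultimately show ?thesis
    by (simp add: join_shortest_def)
qed

section \<open>An isolated dispatcher\<close>

text \<open>
  Tasks arrive at rate \<open>a\<close> and join a shortest queue in \<open>M\<close>; every server works at rate \<open>m\<close>.  The servers
  outside \<open>M\<close> are kept, so that the system lives on the same states as the original process.  The
  time step \<open>\<epsilon>\<close> is small enough for \<open>I + \<epsilon> L'\<close> to be a Markov operator.
\<close>

locale isolated_dispatcher =
  fixes a m \<epsilon> :: real and M :: "'s::finite set"
  assumes a_nonneg: "a \<ge> 0" and m_nonneg: "m \<ge> 0" and eps_pos: "\<epsilon> > 0"
    and eps_small: "\<epsilon> * (a + m * real CARD('s)) \<le> 1"
    and M_nonempty: "M \<noteq> {}"
begin

definition isolated_generator :: "(('s \<Rightarrow> nat) \<Rightarrow> real) \<Rightarrow> ('s \<Rightarrow> nat) \<Rightarrow> real" where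
  "isolated_generator f x =
     a * (join_shortest M f x - f x) + m * (\<Sum>w\<in>UNIV. f (x(w := x w - 1)) - f x)"

definition step :: "(('s \<Rightarrow> nat) \<Rightarrow> real) \<Rightarrow> ('s \<Rightarrow> nat) \<Rightarrow> real" where
  "step f x = f x + \<epsilon> * isolated_generator f x"

text \<open>
  Uniformization: \<open>step\<close> averages over no event, an arrival, and a potential service completion at each
  server.  With nonnegative weights, each property of \<open>step\<close> reduces to the same property of these maps.
\<close>

lemma step_convex_combination:
  "step f x = (1 - \<epsilon> * (a + m * real CARD('s))) * f x + \<epsilon> * a * join_shortest M f x
     + \<epsilon> * m * (\<Sum>w\<in>UNIV. f (x(w := x w - 1)))"
  by (simp add: step_def isolated_generator_def sum_subtractf algebra_simps)

lemma step_mono: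
  assumes "mono f"
  shows "mono (step f)"
proof (rule monoI)
  fix x y :: "'s \<Rightarrow> nat"
  assume xy: "x \<le> y"
  have "f (x(w := x w - 1)) \<le> f (y(w := y w - 1))" for w
    by (rule monoD[OF assms]) (use xy in \<open>auto simp: le_fun_def intro: diff_le_mono\<close>)
  then show "step f x \<le> step f y"
    unfolding step_convex_combination
    using a_nonneg m_nonneg eps_pos eps_small
    by (intro add_mono mult_left_mono sum_mono monoD[OF assms xy]
          join_shortest_mono[OF assms M_nonempty xy]) auto
qed

lemma step_mono_fun:
  assumes "\<And>x. f x \<le> g x"
  shows "step f x \<le> step g x"
  unfolding step_convex_combination
  using a_nonneg m_nonneg eps_pos eps_small
  by (intro add_mono mult_left_mono sum_mono assms join_shortest_mono_fun) auto

lemma step_linear: "step (\<lambda>x. c * f x + d * g x) x = c * step f x + d * step g x"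
  by (simp add: step_convex_combination join_shortest_linear sum.distrib
      sum_distrib_left[symmetric] algebra_simps)

lemma step_const: "step (\<lambda>x. c) x = c"
  by (simp add: step_def isolated_generator_def join_shortest_const[OF M_nonempty])

lemma step_relabel:
  assumes "bij \<sigma>" "\<sigma> ` M = M"
  shows "step (\<lambda>x. f (x \<circ> \<sigma>)) x = step f (x \<circ> \<sigma>)"
proof -
  have "(\<Sum>w\<in>UNIV. f ((x \<circ> \<sigma>)(w := (x \<circ> \<sigma>) w - 1))) = (\<Sum>w\<in>UNIV. f (x(w := x w - 1) \<circ> \<sigma>))"
    unfolding fun_upd_comp_bij[OF assms(1)] comp_apply
    by (rule sum.reindex_bij_betw[OF assms(1), of "\<lambda>w. f (x(w := x w - 1) \<circ> \<sigma>)", unfolded comp_def])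
  then show ?thesis
    by (simp add: step_convex_combination join_shortest_relabel[OF assms])
qed

text \<open>
  The empty state is minimal, so an increasing function cannot decrease in mean from there.  This
  makes the iterates at the empty state increase with time.
\<close>

lemma step_ge_at_0:
  assumes "mono f"
  shows "f (\<lambda>_. 0) \<le> step f (\<lambda>_. 0)"
proof -
  have "(\<lambda>_. 0 :: nat)(w := 0 - 1) = (\<lambda>_. 0)" for w :: 's by auto
  then show ?thesis
    using join_shortest_ge[OF assms M_nonempty, of "\<lambda>_. 0"] a_nonneg eps_pos
    by (simp add: step_def isolated_generator_def)
qed

lemma iterate_mono: "mono f \<Longrightarrow> mono ((step ^^ n) f)"
  by (induction n) (auto intro: step_mono)

lemma iterate_mono_fun: "(\<And>x. f x \<le> g x) \<Longrightarrow> (step ^^ n) f x \<le> (step ^^ n) g x"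
  by (induction n arbitrary: x) (auto intro: step_mono_fun)

lemma iterate_linear:
  "(step ^^ n) (\<lambda>x. c * f x + d * g x) = (\<lambda>x. c * (step ^^ n) f x + d * (step ^^ n) g x)"
  by (induction n) (auto simp: step_linear)

lemma iterate_const: "(step ^^ n) (\<lambda>x. c) = (\<lambda>x. c)"
  by (induction n) (auto simp: step_const)

lemma iterate_sum:
  "finite I \<Longrightarrow> (step ^^ n) (\<lambda>x. \<Sum>i\<in>I. f i x) = (\<lambda>x. \<Sum>i\<in>I. (step ^^ n) (f i) x)"
proof (induction I rule: finite_induct)
  case empty
  then show ?case by (simp add: iterate_const)
next
  case (insert i I)
  then show ?case
    using iterate_linear[of n 1 "f i" 1 "\<lambda>x. \<Sum>i\<in>I. f i x"] by simp
qed

lemma iterate_relabel: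
  assumes "bij \<sigma>" "\<sigma> ` M = M"
  shows "(step ^^ n) (\<lambda>x. f (x \<circ> \<sigma>)) x = (step ^^ n) f (x \<circ> \<sigma>)"
proof (induction n arbitrary: x)
  case (Suc n)
  then have "(step ^^ n) (\<lambda>x. f (x \<circ> \<sigma>)) = (\<lambda>x. (step ^^ n) f (x \<circ> \<sigma>))" by blast
  then show ?case
    using step_relabel[OF assms, of "(step ^^ n) f" x] by (simp del: o_apply add: o_apply[of step])
qed simp

lemma iterate_range:
  assumes "\<And>x. 0 \<le> f x" "\<And>x. f x \<le> 1"
  shows "0 \<le> (step ^^ n) f x" "(step ^^ n) f x \<le> 1"
  using iterate_mono_fun[of "\<lambda>_. 0" f n x] iterate_mono_fun[of f "\<lambda>_. 1" n x] assms
  by (simp_all add: iterate_const)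

lemma iterate_incseq_at_0:
  assumes "mono f"
  shows "incseq (\<lambda>n. (step ^^ n) f (\<lambda>_. 0))"
  using step_ge_at_0[OF iterate_mono[OF assms]] by (intro incseq_SucI) simp

text \<open>
  The empty state and the dynamics are invariant under swapping two servers of \<open>M\<close>.
\<close>

lemma iterate_exchangeable:
  fixes i :: nat
  assumes "u \<in> M" "v \<in> M"
  shows "(step ^^ n) (\<lambda>x. of_bool (x v \<ge> i)) (\<lambda>_. 0) = (step ^^ n) (\<lambda>x. of_bool (x u \<ge> i)) (\<lambda>_. 0)"
proof -
  let ?\<sigma> = "Transposition.transpose u v"
  have "?\<sigma> ` M = M"
    using assms by (simp add: transpose_image_eq)
  then have "(step ^^ n) (\<lambda>x. of_bool ((x \<circ> ?\<sigma>) u \<ge> i)) (\<lambda>_. 0)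
      = (step ^^ n) (\<lambda>x. of_bool (x u \<ge> i)) ((\<lambda>_. 0) \<circ> ?\<sigma>)"
    by (intro iterate_relabel[of ?\<sigma> n "\<lambda>x. of_bool (x u \<ge> i)"]) simp_all
  then show ?thesis by (simp add: comp_def)
qed

definition backlog_ge :: "nat \<Rightarrow> ('s \<Rightarrow> nat) \<Rightarrow> real" where
  "backlog_ge j x = of_bool ((\<Sum>w\<in>M. x w) \<ge> j)"

lemma backlog_ge_mono: "mono (backlog_ge j)"
proof (rule monoI)
  fix x y :: "'s \<Rightarrow> nat"
  assume "x \<le> y"
  then have "(\<Sum>w\<in>M. x w) \<le> (\<Sum>w\<in>M. y w)"
    by (intro sum_mono) (simp add: le_fun_def)
  then show "backlog_ge j x \<le> backlog_ge j y"
    by (simp add: backlog_ge_def)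
qed

lemma backlog_ge_range: "0 \<le> backlog_ge j x" "backlog_ge j x \<le> 1"
  by (simp_all add: backlog_ge_def)

lemma backlog_ge_0: "backlog_ge 0 = (\<lambda>_. 1)"
  by (simp add: backlog_ge_def fun_eq_iff)

lemma backlog_ge_antimono: "backlog_ge (Suc j) x \<le> backlog_ge j x"
  by (simp add: backlog_ge_def)

text \<open>
  The backlog of \<open>M\<close> crosses from \<open>j\<close> to \<open>j + 1\<close> at rate exactly \<open>a\<close>, and back at rate \<open>m\<close> times the number
  of busy servers in \<open>M\<close>, which is at most \<open>card M\<close>.
\<close>

lemma isolated_generator_backlog:
  "a * (backlog_ge j x - backlog_ge (Suc j) x)
     - real (card M) * m * (backlog_ge (Suc j) x - backlog_ge (Suc (Suc j)) x)
   \<le> isolated_generator (backlog_ge (Suc j)) x"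
proof -
  let ?T = "\<Sum>w\<in>M. x w"
  let ?D = "backlog_ge (Suc j) x - backlog_ge (Suc (Suc j)) x"
  have up: "(\<Sum>v\<in>M. (x(w := x w + 1)) v) = Suc ?T" if "w \<in> M" for w
  proof -
    have "(\<Sum>v\<in>M - {w}. (x(w := x w + 1)) v) = (\<Sum>v\<in>M - {w}. x v)"
      by (intro sum.cong) auto
    then show ?thesis using that by (simp add: sum.remove[of M w])
  qed
  have down: "?T - 1 \<le> (\<Sum>v\<in>M. (x(w := x w - 1)) v)" if "w \<in> M" for w
  proof -
    have "(\<Sum>v\<in>M - {w}. (x(w := x w - 1)) v) = (\<Sum>v\<in>M - {w}. x v)"
      by (intro sum.cong) auto
    then show ?thesis using that by (simp add: sum.remove[of M w])
  qed
  have off: "(\<Sum>v\<in>M. (x(w := x w - 1)) v) = ?T" if "w \<notin> M" for w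
    using that by (intro sum.cong) auto
  have "join_shortest M (backlog_ge (Suc j)) x = join_shortest M (\<lambda>_. backlog_ge j x) x"
  proof -
    have "backlog_ge (Suc j) (x(w := x w + 1)) = backlog_ge j x" if "w \<in> shortest_in M x" for w
      using that unfolding backlog_ge_def by (subst up) (auto simp: shortest_in_def)
    then show ?thesis
      unfolding join_shortest_def by simp
  qed
  then have J: "join_shortest M (backlog_ge (Suc j)) x = backlog_ge j x"
    by (simp add: join_shortest_const[OF M_nonempty])
  have "- (of_bool (w \<in> M) * ?D) \<le> backlog_ge (Suc j) (x(w := x w - 1)) - backlog_ge (Suc j) x" for w
  proof (cases "w \<in> M")
    case True
    then show ?thesis
      using down[OF True] by (auto simp: backlog_ge_def simp del: fun_upd_apply)
  next
    case False
    then show ?thesis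
      unfolding backlog_ge_def by (subst off) auto
  qed
  then have "(\<Sum>w\<in>UNIV. - (of_bool (w \<in> M) * ?D))
      \<le> (\<Sum>w\<in>UNIV. backlog_ge (Suc j) (x(w := x w - 1)) - backlog_ge (Suc j) x)"
    by (intro sum_mono)
  moreover have "(\<Sum>w\<in>UNIV. - (of_bool (w \<in> M) * ?D)) = - (real (card M) * ?D)"
    by (simp add: sum_negf flip: sum_distrib_right)
  ultimately have "m * (- (real (card M) * ?D))
      \<le> m * (\<Sum>w\<in>UNIV. backlog_ge (Suc j) (x(w := x w - 1)) - backlog_ge (Suc j) x)"
    using m_nonneg by (intro mult_left_mono) auto
  then show ?thesis
    unfolding isolated_generator_def J by (simp add: algebra_simps)
qed

end

section \<open>Geometric tail of the isolated backlog\<close>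

text \<open>
  The hypothesis is the cut inequality of a birth and death chain with birth rate \<open>a\<close> and death rate
  \<open>b\<close>, written for the tail probabilities \<open>c\<close>.  It says that \<open>b * c (j + 1) - a * c j\<close> decreases in \<open>j\<close>;
  since its limit \<open>(b - a) * l\<close> is nonnegative, so are all its terms.  The limit \<open>l\<close> is kept general because
  two cases occur: \<open>l = 0\<close> with \<open>a\<close> and \<open>b\<close> not yet compared, and \<open>a \<le> b\<close> with unknown \<open>l \<ge> 0\<close>.
\<close>

lemma geometric_lower_bound:
  fixes c :: "nat \<Rightarrow> real"
  assumes rel: "\<And>j. a * (c j - c (Suc j)) \<le> b * (c (Suc j) - c (Suc (Suc j)))"
    and lim: "c \<longlonglongrightarrow> l" and l: "0 \<le> (b - a) * l" and a: "a \<ge> 0" and b: "b > 0"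
  shows "(a / b) ^ j * c 0 \<le> c j"
proof -
  define D where "D j = b * c (Suc j) - a * c j" for j
  have "decseq D"
    using rel by (intro decseq_SucI) (simp add: D_def algebra_simps)
  moreover have "D \<longlonglongrightarrow> b * l - a * l"
    unfolding D_def by (intro tendsto_intros LIMSEQ_Suc lim)
  ultimately have D: "0 \<le> D j" for j
    using decseq_ge[of D _ j] l by (fastforce simp: algebra_simps)
  show ?thesis
  proof (induction j)
    case (Suc j)
    have "(a / b) ^ Suc j * c 0 \<le> (a / b) * c j"
      using mult_left_mono[OF Suc, of "a / b"] a b by (simp add: mult.assoc)
    also have "\<dots> \<le> c (Suc j)"
      using D[of j] b by (simp add: D_def field_simps)
    finally show ?case .
  qed simp
qed

text \<open>
  Started empty, the backlog grows stochastically, so its tail probabilities converge.  Their increments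
  then tend to 0, and in the limit the one-step inequality for the backlog becomes the cut inequality.
  If these limits do not tend to 0 as \<open>j\<close> grows, then mass escapes to infinity, which only raises the
  tails; \<open>geometric_lower_bound\<close> covers this case.
\<close>

lemma (in isolated_dispatcher) iterate_backlog_limit:
  assumes le: "a \<le> real (card M) * m" and m: "m > 0"
  obtains l where "(\<lambda>n. (step ^^ n) (backlog_ge j) (\<lambda>_. 0)) \<longlonglongrightarrow> l"
    and "(a / (real (card M) * m)) ^ j \<le> l"
proof -
  let ?k = "real (card M)"
  have k: "?k > 0" using M_nonempty by (simp add: card_gt_0_iff)
  define c where "c n j = (step ^^ n) (backlog_ge j) (\<lambda>_. 0)" for n j
  define l where "l j = lim (\<lambda>n. c n j)" for j
  have range: "0 \<le> c n j" "c n j \<le> 1" for n j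
    unfolding c_def by (intro iterate_range backlog_ge_range)+
  have lim: "(\<lambda>n. c n j) \<longlonglongrightarrow> l j" for j
  proof -
    have "incseq (\<lambda>n. c n j)"
      unfolding c_def by (rule iterate_incseq_at_0[OF backlog_ge_mono])
    moreover have "Bseq (\<lambda>n. c n j)"
      using range[of _ j] by (intro BseqI'[of _ 1]) (simp add: abs_le_iff order_trans[OF _ range(1)])
    ultimately show ?thesis
      unfolding l_def by (intro convergent_LIMSEQ_iff[THEN iffD1] Bseq_monoseq_convergent)
        (auto simp: monoseq_iff)
  qed
  have rec: "\<epsilon> * (a * (c n j - c n (Suc j)) - ?k * m * (c n (Suc j) - c n (Suc (Suc j))))
      \<le> c (Suc n) (Suc j) - c n (Suc j)" for n j
  proof -
    \<comment> \<open>The lower bound on the generator written as a combination with constant coefficients, in the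
       nested binary form to which linearity of the iterates applies.\<close>
    let ?\<phi> = "\<lambda>x. \<epsilon> * a * backlog_ge j x
       + 1 * ((1 - \<epsilon> * a - \<epsilon> * (?k * m)) * backlog_ge (Suc j) x + \<epsilon> * (?k * m) * backlog_ge (Suc (Suc j)) x)"
    have "?\<phi> x \<le> step (backlog_ge (Suc j)) x" for x
      using mult_left_mono[OF isolated_generator_backlog[of j x], of \<epsilon>] eps_pos
      unfolding step_def by (simp add: algebra_simps)
    then have "(step ^^ n) ?\<phi> (\<lambda>_. 0) \<le> (step ^^ n) (step (backlog_ge (Suc j))) (\<lambda>_. 0)"
      by (rule iterate_mono_fun)
    also have "\<dots> = c (Suc n) (Suc j)"
      by (simp add: c_def funpow_swap1)
    finally show ?thesis
      unfolding iterate_linear c_def[symmetric] by (simp add: algebra_simps)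
  qed
  have rel: "a * (l j - l (Suc j)) \<le> ?k * m * (l (Suc j) - l (Suc (Suc j)))" for j
  proof -
    have "(\<lambda>n. \<epsilon> * (a * (c n j - c n (Suc j)) - ?k * m * (c n (Suc j) - c n (Suc (Suc j)))))
      \<longlonglongrightarrow> \<epsilon> * (a * (l j - l (Suc j)) - ?k * m * (l (Suc j) - l (Suc (Suc j))))"
      by (intro tendsto_intros lim)
    moreover have "(\<lambda>n. c (Suc n) (Suc j) - c n (Suc j)) \<longlonglongrightarrow> l (Suc j) - l (Suc j)"
      by (intro tendsto_intros lim LIMSEQ_Suc)
    ultimately have "\<epsilon> * (a * (l j - l (Suc j)) - ?k * m * (l (Suc j) - l (Suc (Suc j)))) \<le> 0"
      using rec LIMSEQ_le by fastforce
    then show ?thesis using eps_pos by (simp add: mult_le_0_iff)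
  qed
  have l_nonneg: "0 \<le> l j" for j
    by (rule LIMSEQ_le_const[OF lim]) (use range in blast)
  have "decseq l"
  proof (rule decseq_SucI)
    fix j
    show "l (Suc j) \<le> l j"
      by (rule LIMSEQ_le[OF lim lim])
        (auto simp: c_def intro!: exI[of _ 0] iterate_mono_fun backlog_ge_antimono)
  qed
  then obtain L where L: "l \<longlonglongrightarrow> L" "\<And>j. L \<le> l j"
    using decseq_convergent[of l 0] l_nonneg by blast
  have "0 \<le> L"
    by (rule LIMSEQ_le_const[OF L(1)]) (use l_nonneg in blast)
  then have "(a / (?k * m)) ^ j * l 0 \<le> l j"
    using le k m a_nonneg by (intro geometric_lower_bound[OF rel L(1)]) auto
  moreover have "l 0 = 1"
    by (simp add: l_def c_def backlog_ge_0 iterate_const lim_const)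
  ultimately show ?thesis
    using that lim[of j] by (simp add: c_def)
qed

text \<open>
  Pigeonhole principle for the tasks in \<open>M\<close>.
\<close>

lemma (in isolated_dispatcher) sum_of_tails_ge:
  "backlog_ge (card M * i) x \<le> (\<Sum>v\<in>M. of_bool (x v \<ge> i))"
proof (cases "\<exists>v\<in>M. x v \<ge> i")
  case True
  then obtain v where v: "v \<in> M" "x v \<ge> i" by blast
  have "1 \<le> (\<Sum>v\<in>M. of_bool (x v \<ge> i) :: real)"
    using member_le_sum[of v M "\<lambda>v. of_bool (x v \<ge> i) :: real"] v by simp
  then show ?thesis using backlog_ge_range(2) order_trans by blast
next
  case False
  then have "(\<Sum>v\<in>M. x v) < (\<Sum>v\<in>M. i)"
    using M_nonempty by (intro sum_strict_mono) auto
  then show ?thesis by (simp add: backlog_ge_def sum_nonneg)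
qed

section \<open>Comparison with the load balancing process\<close>

text \<open>
  The process has at least the arrivals of \<open>d\<close>, and all its arrivals raise an increasing \<open>f\<close>; it has at
  most the departures of the isolated system, and departures lower \<open>f\<close>.
\<close>

lemma (in isolated_dispatcher) isolated_generator_le:
  fixes E :: "('d::finite \<times> 's::finite) set"
  assumes M: "M = servers_of E d" and lam: "\<And>d. lam d \<ge> 0" and a_le: "a \<le> lam d"
    and mu: "\<And>u. \<mu> u \<le> m" and f: "mono f"
  shows "isolated_generator f x \<le> load_balancing_generator E lam \<mu> f x"
proof -
  have S: "shortest_queues E x d = shortest_in M x"
    by (simp add: shortest_queues_def shortest_in_def M)
  have c: "real (card (shortest_in M x)) > 0"
    using shortest_in_nonempty[OF M_nonempty, of x] by (simp add: card_gt_0_iff)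
  have up: "f x \<le> f (x(w := x w + 1))" for w
    by (rule monoD[OF f]) (auto simp: le_fun_def)
  have down: "f (x(w := x w - 1)) \<le> f x" for w
    by (rule monoD[OF f]) (auto simp: le_fun_def)
  have rate: "a / real (card (shortest_in M x)) \<le> arrival_rate E lam x u" if "u \<in> shortest_in M x" for u
  proof -
    have "d \<in> dispatchers_of E u"
      using that by (simp add: shortest_in_def M servers_of_def dispatchers_of_def)
    then have "lam d * of_bool (u \<in> shortest_queues E x d) / real (card (shortest_queues E x d))
        \<le> arrival_rate E lam x u"
      unfolding arrival_rate_def by (intro member_le_sum) (auto simp: lam)
    then show ?thesis
      using that a_le c by (auto simp: S intro: order_trans[OF divide_right_mono])
  qed
  have "a * (join_shortest M f x - f x)
      = (\<Sum>w\<in>shortest_in M x. a / real (card (shortest_in M x)) * (f (x(w := x w + 1)) - f x))"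
    unfolding sum_distrib_left[symmetric] sum_subtractf
    using shortest_in_nonempty[OF M_nonempty, of x]
    by (simp add: join_shortest_def diff_divide_distrib right_diff_distrib)
  also have "\<dots> \<le> (\<Sum>w\<in>shortest_in M x. arrival_rate E lam x w * (f (x(w := x w + 1)) - f x))"
    using up by (intro sum_mono mult_right_mono rate) auto
  also have "\<dots> \<le> (\<Sum>w\<in>UNIV. arrival_rate E lam x w * (f (x(w := x w + 1)) - f x))"
    using up arrival_rate_nonneg[of lam E x, OF lam] by (intro sum_mono2) (auto intro!: mult_nonneg_nonneg)
  finally have "a * (join_shortest M f x - f x) \<le> \<dots>" .
  moreover have "m * (f (x(w := x w - 1)) - f x) \<le> \<mu> w * (f (x(w := x w - 1)) - f x)" for w
    using mu down by (intro mult_right_mono_neg) auto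
  then have "m * (\<Sum>w\<in>UNIV. f (x(w := x w - 1)) - f x) \<le> (\<Sum>w\<in>UNIV. \<mu> w * (f (x(w := x w - 1)) - f x))"
    unfolding sum_distrib_left by (intro sum_mono)
  ultimately show ?thesis
    unfolding isolated_generator_def load_balancing_generator_def by linarith
qed

lemma integrable_pmf_bounded:
  fixes f :: "'a \<Rightarrow> real"
  assumes "\<And>x. \<bar>f x\<bar> \<le> B"
  shows "integrable (measure_pmf \<pi>) f"
  by (rule measure_pmf.integrable_const_bound[where B = B]) (use assms in auto)

text \<open>
  Since \<open>step\<close> keeps functions increasing, the hypothesis can be applied along the whole orbit of \<open>f\<close>, so
  the mean of the iterates under \<open>\<pi>\<close> never increases.  An increasing function is smallest at the empty
  state, which brings in the value there.
\<close>

lemma (in isolated_dispatcher) iterate_le_stationary: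
  fixes \<pi> :: "('s \<Rightarrow> nat) pmf"
  assumes sub: "\<And>f. mono f \<Longrightarrow> (\<And>x. 0 \<le> f x) \<Longrightarrow> (\<And>x. f x \<le> 1)
      \<Longrightarrow> measure_pmf.expectation \<pi> (isolated_generator f) \<le> 0"
    and f: "mono f" "\<And>x. 0 \<le> f x" "\<And>x. f x \<le> 1"
  shows "(step ^^ n) f (\<lambda>_. 0) \<le> measure_pmf.expectation \<pi> f"
proof -
  have int: "integrable (measure_pmf \<pi>) ((step ^^ n) f)" for n
    by (rule integrable_pmf_bounded[where B = 1])
      (use iterate_range[of f n] f in \<open>auto simp: abs_le_iff intro: order_trans[OF _ iterate_range(1)]\<close>)
  have "measure_pmf.expectation \<pi> ((step ^^ n) f) \<le> measure_pmf.expectation \<pi> f"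
  proof (induction n)
    case (Suc n)
    let ?g = "(step ^^ n) f"
    have gen: "isolated_generator ?g = (\<lambda>x. (step ?g x - ?g x) / \<epsilon>)"
      using eps_pos by (simp add: step_def fun_eq_iff)
    have "measure_pmf.expectation \<pi> (isolated_generator ?g)
        = (measure_pmf.expectation \<pi> (step ?g) - measure_pmf.expectation \<pi> ?g) / \<epsilon>"
      unfolding gen using int[of n] int[of "Suc n"] by simp
    moreover have "measure_pmf.expectation \<pi> (isolated_generator ?g) \<le> 0"
      using f by (intro sub iterate_mono iterate_range)
    ultimately have "measure_pmf.expectation \<pi> (step ?g) \<le> measure_pmf.expectation \<pi> ?g"
      using eps_pos by (simp add: divide_le_0_iff)
    then show ?case using Suc by simp
  qed simp
  moreover have "(step ^^ n) f (\<lambda>_. 0) \<le> measure_pmf.expectation \<pi> ((step ^^ n) f)"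
  proof -
    have "measure_pmf.expectation \<pi> (\<lambda>_. (step ^^ n) f (\<lambda>_. 0)) \<le> measure_pmf.expectation \<pi> ((step ^^ n) f)"
      by (intro integral_mono int) (auto intro!: monoD[OF iterate_mono[OF f(1)]] simp: le_fun_def)
    then show ?thesis by simp
  qed
  ultimately show ?thesis by linarith
qed

text \<open>
  The cut inequalities are used twice.  Under \<open>\<pi>\<close> itself the backlog tails tend to 0 and dominate
  \<open>(a / (k * m)) ^ j\<close>, which forces \<open>a \<le> k * m\<close>.  This makes the tail bound for the isolated system
  available, and exchangeability distributes it evenly over the \<open>k\<close> servers of \<open>d\<close>.  The law \<open>\<pi>\<close> is not
  exchangeable, so the second step needs the isolated system.
\<close>

lemma server_tail_bound:
  fixes E :: "('d::finite \<times> 's::finite) set"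
  assumes lam: "\<And>d. lam d \<ge> 0" and mu: "\<And>u. \<mu> u \<ge> 0"
    and proc: "load_balancing_process E lam \<mu> P X"
    and st: "stationary_distribution P X \<pi>"
    and edge: "(d, u) \<in> E"
    and a: "0 \<le> a" "a \<le> lam d" and m: "0 < m" "\<And>u. \<mu> u \<le> m"
  defines "k \<equiv> real (dispatcher_degree E d)"
  shows "a \<le> k * m"
    and "(a / (k * m)) ^ (dispatcher_degree E d * i) / k
      \<le> measure_pmf.expectation \<pi> (\<lambda>x. of_bool (x u \<ge> i))"
proof -
  define M where "M = servers_of E d"
  have uM: "u \<in> M" using edge by (simp add: M_def servers_of_def)
  have k_card: "k = real (card M)" "dispatcher_degree E d = card M"
    by (simp_all add: k_def M_def dispatcher_degree_def)
  have k: "k > 0" using uM by (auto simp: k_card card_gt_0_iff)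
  define \<epsilon> where "\<epsilon> = 1 / (a + m * real CARD('s))"
  have den: "a + m * real CARD('s) > 0"
    using a m by (simp add: add_nonneg_pos)
  interpret isolated_dispatcher a m \<epsilon> M
    using a m den uM by unfold_locales (auto simp: \<epsilon>_def)
  have gen_bound: "\<bar>load_balancing_generator E lam \<mu> f x\<bar>
      \<le> (\<Sum>u\<in>(UNIV::'s set). (\<Sum>d\<in>UNIV. lam d) * (2 * 1)) + (\<Sum>u\<in>UNIV. \<mu> u * (2 * 1))"
    if "\<And>x. 0 \<le> f x" "\<And>x. f x \<le> 1" for f x
    using that by (intro load_balancing_generator_bounded lam mu) (auto simp: abs_le_iff intro: order_trans[OF _ that(1)])
  have unit: "\<bar>f x\<bar> \<le> 1" if "\<And>x. 0 \<le> f x" "\<And>x. f x \<le> 1" for f :: "('s \<Rightarrow> nat) \<Rightarrow> real" and x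
    using that[of x] by simp
  have below: "measure_pmf.expectation \<pi> g \<le> 0"
    if "mono f" "\<And>x. 0 \<le> f x" "\<And>x. f x \<le> 1" "integrable (measure_pmf \<pi>) g"
      "\<And>x. g x \<le> isolated_generator f x" for f g
  proof -
    have "measure_pmf.expectation \<pi> g \<le> measure_pmf.expectation \<pi> (load_balancing_generator E lam \<mu> f)"
    proof (rule integral_mono[OF that(4)])
      show "integrable (measure_pmf \<pi>) (load_balancing_generator E lam \<mu> f)"
        by (rule integrable_pmf_bounded, rule gen_bound) (use that in auto)
      show "g x \<le> load_balancing_generator E lam \<mu> f x" for x
        using that(5)[of x] isolated_generator_le[where lam = lam and \<mu> = \<mu> and x = x, OF M_def lam a(2) m(2) that(1)]
        by linarith
    qed
    also have "\<dots> = 0"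
      by (rule stationary_generator_zero[OF lam mu proc st unit]) (use that in auto)
    finally show ?thesis .
  qed
  define b where "b j = measure_pmf.expectation \<pi> (backlog_ge j)" for j
  have int: "integrable (measure_pmf \<pi>) (backlog_ge j)" for j
    by (rule integrable_pmf_bounded[OF unit]) (auto simp: backlog_ge_range)
  have b_rel: "a * (b j - b (Suc j)) \<le> k * m * (b (Suc j) - b (Suc (Suc j)))" for j
  proof -
    let ?g = "\<lambda>x. a * (backlog_ge j x - backlog_ge (Suc j) x)
        - k * m * (backlog_ge (Suc j) x - backlog_ge (Suc (Suc j)) x)"
    have "measure_pmf.expectation \<pi> ?g \<le> 0"
      by (rule below[OF backlog_ge_mono backlog_ge_range])
        (use isolated_generator_backlog in \<open>auto simp: int k_card\<close>)
    then show ?thesis by (simp add: int b_def)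
  qed
  have b_lim: "b \<longlonglongrightarrow> 0"
  proof -
    have "b \<longlonglongrightarrow> measure_pmf.expectation \<pi> (\<lambda>_. 0)"
      unfolding b_def
    proof (rule integral_dominated_convergence[where w = "\<lambda>_. 1"])
      have "(\<lambda>j. backlog_ge j x) \<longlonglongrightarrow> 0" for x
      proof (rule tendsto_eventually)
        show "\<forall>\<^sub>F j in sequentially. backlog_ge j x = 0"
          using eventually_gt_at_top[of "\<Sum>w\<in>M. x w"]
          by eventually_elim (simp add: backlog_ge_def)
      qed
      then show "AE x in measure_pmf \<pi>. (\<lambda>j. backlog_ge j x) \<longlonglongrightarrow> 0" by simp
    qed (auto simp: unit backlog_ge_range)
    then show ?thesis by simp
  qed
  show le: "a \<le> k * m"
  proof (rule ccontr)
    assume "\<not> a \<le> k * m"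
    then have "1 \<le> (a / (k * m)) ^ j" for j
      using k m by (intro one_le_power) simp
    moreover have "(a / (k * m)) ^ j * b 0 \<le> b j" for j
      by (rule geometric_lower_bound[OF b_rel b_lim]) (use a k m in auto)
    moreover have "b 0 = 1" by (simp add: b_def backlog_ge_0)
    ultimately have "1 \<le> b j" for j
      using order_trans by fastforce
    then have "1 \<le> (0::real)"
      by (intro LIMSEQ_le_const[OF b_lim]) blast
    then show False by simp
  qed
  show "(a / (k * m)) ^ (dispatcher_degree E d * i) / k
      \<le> measure_pmf.expectation \<pi> (\<lambda>x. of_bool (x u \<ge> i))"
  proof -
    let ?h = "\<lambda>v (x :: 's \<Rightarrow> nat). of_bool (x v \<ge> i) :: real"
    let ?c = "\<lambda>n. (step ^^ n) (backlog_ge (card M * i)) (\<lambda>_. 0)"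
    have h_mono: "mono (?h v)" for v
      by (rule monoI) (auto simp: le_fun_def intro: order_trans)
    have bound: "?c n \<le> k * measure_pmf.expectation \<pi> (?h u)" for n
    proof -
      have "?c n \<le> (step ^^ n) (\<lambda>x. \<Sum>v\<in>M. ?h v x) (\<lambda>_. 0)"
        by (intro iterate_mono_fun sum_of_tails_ge)
      also have "\<dots> = (\<Sum>v\<in>M. (step ^^ n) (?h v) (\<lambda>_. 0))"
        by (simp only: iterate_sum finite)
      also have "\<dots> = (\<Sum>v\<in>M. (step ^^ n) (?h u) (\<lambda>_. 0))"
        by (intro sum.cong iterate_exchangeable uM) auto
      also have "\<dots> = k * (step ^^ n) (?h u) (\<lambda>_. 0)"
        by (simp add: k_card)
      also have "\<dots> \<le> k * measure_pmf.expectation \<pi> (?h u)"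
      proof (intro mult_left_mono iterate_le_stationary h_mono)
        fix f :: "('s \<Rightarrow> nat) \<Rightarrow> real"
        assume f: "mono f" "\<And>x. 0 \<le> f x" "\<And>x. f x \<le> 1"
        have "isolated_generator f = (\<lambda>x. (step f x - f x) / \<epsilon>)"
          using eps_pos by (simp add: step_def fun_eq_iff)
        moreover have "integrable (measure_pmf \<pi>) f" "integrable (measure_pmf \<pi>) (step f)"
          using f iterate_range[of f 1] by (auto intro!: integrable_pmf_bounded[OF unit])
        ultimately have "integrable (measure_pmf \<pi>) (isolated_generator f)"
          by simp
        then show "measure_pmf.expectation \<pi> (isolated_generator f) \<le> 0"
          by (rule below[OF f]) simp
      qed (use k in auto)
      finally show ?thesis .
    qed
    obtain l where l: "?c \<longlonglongrightarrow> l" "(a / (real (card M) * m)) ^ (card M * i) \<le> l"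
      using iterate_backlog_limit[of "card M * i"] le m by (auto simp: k_card)
    have "l \<le> k * measure_pmf.expectation \<pi> (?h u)"
      by (rule LIMSEQ_le_const2[OF l(1)]) (use bound in blast)
    then show ?thesis
      using l(2) k by (simp add: k_card pos_divide_le_eq mult.commute)
  qed
qed

section \<open>Convexity in the degree\<close>

text \<open>
  This is \<open>r_fun \<rho> x ^ n / x\<close> with a real exponent \<open>n\<close>, in exponential form for differentiation.
\<close>

definition occupancy_bound :: "real \<Rightarrow> real \<Rightarrow> real \<Rightarrow> real" where
  "occupancy_bound n \<rho> x = exp (n * x * (ln \<rho> - ln x) - ln x)"

lemma occupancy_bound_eq:
  assumes "\<rho> > 0" "x > 0"
  shows "occupancy_bound (real i) \<rho> x = r_fun \<rho> x ^ i / x"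
  using assms
  by (simp add: occupancy_bound_def r_fun_def powr_def exp_diff ln_div exp_of_nat_mult[symmetric] mult.assoc)

text \<open>
  Writing \<open>g\<close> for the function and \<open>\<phi>\<close> for its logarithmic derivative, \<open>g'' = g * (\<phi>\<^sup>2 + \<phi>')\<close> with
  \<open>\<phi>' = 1 / x\<^sup>2 - n / x\<close>.  For \<open>x \<ge> \<rho>\<close> one has \<open>\<phi> \<le> - (n + 1 / x)\<close>, and the cross term \<open>2 * n / x\<close> of the square
  compensates the negative term of \<open>\<phi>'\<close>.
\<close>

lemma occupancy_bound_convex:
  assumes "\<rho> > 0" and "n \<ge> 0"
  shows "convex_on {\<rho>..} (occupancy_bound n \<rho>)"
proof -
  let ?g = "occupancy_bound n \<rho>"
  let ?\<phi> = "\<lambda>x. n * (ln \<rho> - ln x) - n - 1 / x"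
  show ?thesis
  proof (rule f''_ge0_imp_convex)
    fix x assume "x \<in> {\<rho>..}"
    then have x: "x > 0" "\<rho> \<le> x" using assms by auto
    show "(?g has_real_derivative ?g x * ?\<phi> x) (at x)"
      unfolding occupancy_bound_def using x
      by (auto intro!: derivative_eq_intros simp: field_simps)
    then show "((\<lambda>x. ?g x * ?\<phi> x) has_real_derivative ?g x * (?\<phi> x)\<^sup>2 + ?g x * (1 / x\<^sup>2 - n / x)) (at x)"
      using x by (auto intro!: derivative_eq_intros simp: power2_eq_square field_simps)
    have "n + 1 / x \<le> - ?\<phi> x"
      using x assms mult_left_mono[of "ln \<rho>" "ln x" n] by (simp add: algebra_simps)
    then have "(n + 1 / x)\<^sup>2 \<le> (- ?\<phi> x)\<^sup>2"
      using x assms by (intro power_mono) auto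
    moreover have "(n + 1 / x)\<^sup>2 = n\<^sup>2 + 2 * (n / x) + 1 / x\<^sup>2"
      using x by (simp add: power2_eq_square field_simps)
    moreover have "n / x \<ge> 0" "1 / x\<^sup>2 \<ge> 0" using x assms by auto
    ultimately have "0 \<le> (?\<phi> x)\<^sup>2 + (1 / x\<^sup>2 - n / x)"
      using zero_le_power2[of n] by (simp only: power2_minus)
    then have "0 \<le> ?g x * ((?\<phi> x)\<^sup>2 + (1 / x\<^sup>2 - n / x))"
      by (intro mult_nonneg_nonneg) (simp add: occupancy_bound_def)
    then show "0 \<le> ?g x * (?\<phi> x)\<^sup>2 + ?g x * (1 / x\<^sup>2 - n / x)"
      by (simp add: distrib_left)
  qed simp
qed

section \<open>The occupancy bound\<close>

theorem theorem1:
  fixes E :: "('d::finite \<times> 's::finite) set"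
    and lam :: "'d \<Rightarrow> real" and \<mu> :: "'s \<Rightarrow> real"
    and P :: "('s \<Rightarrow> nat) \<Rightarrow> 'w measure" and X :: "real \<Rightarrow> 'w \<Rightarrow> 's \<Rightarrow> nat"
    and lam\<^sub>0 \<mu>\<^sub>0 \<rho>\<^sub>0 :: real
    and \<pi> :: "('s \<Rightarrow> nat) pmf"
    and i :: nat
  assumes "no_isolated_nodes E"
    and "\<And>d. lam d > 0"
    and "\<And>u. \<mu> u > 0"
    and "load_balancing_process E lam \<mu> P X"
    and "0 < lam\<^sub>0" and "lam\<^sub>0 \<le> Min (range lam)"
    and "Max (range \<mu>) \<le> \<mu>\<^sub>0"
    and "\<rho>\<^sub>0 = lam\<^sub>0 / \<mu>\<^sub>0"
    and "ergodic_chain P X"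
    and "stationary_distribution P X \<pi>"
    and "real i \<ge> 1 / \<rho>\<^sub>0"
  shows "measure_pmf.expectation \<pi> (\<lambda>x. occupancy x i)
           \<ge> r_fun \<rho>\<^sub>0 (graph_alpha E) ^ i / graph_alpha E"
proof -
  have lam: "lam\<^sub>0 \<le> lam d" for d
    using assms(6) by (rule order_trans) simp
  have mu: "\<mu> u \<le> \<mu>\<^sub>0" for u
    using _ assms(7) by (rule order_trans) simp
  have mu0: "0 < \<mu>\<^sub>0"
    using assms(3) mu by (meson less_le_trans)
  have rho: "0 < \<rho>\<^sub>0" using assms(5,8) mu0 by simp
  define n where "n = real CARD('s)"
  have n: "n > 0" by (simp add: n_def)
  define k where "k u = real (Min (dispatcher_degree E ` dispatchers_of E u))" for u
  have server: "\<rho>\<^sub>0 \<le> k u \<and>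
      occupancy_bound (real i) \<rho>\<^sub>0 (k u) \<le> measure_pmf.expectation \<pi> (\<lambda>x. of_bool (x u \<ge> i))" for u
  proof -
    have "Min (dispatcher_degree E ` dispatchers_of E u) \<in> dispatcher_degree E ` dispatchers_of E u"
      using assms(1) by (intro Min_in) (auto simp: no_isolated_nodes_def)
    then obtain d where d: "(d, u) \<in> E" "k u = real (dispatcher_degree E d)"
      by (auto simp: dispatchers_of_def k_def)
    have "u \<in> servers_of E d" using d(1) by (simp add: servers_of_def)
    then have k_pos: "k u > 0"
      by (auto simp: d(2) dispatcher_degree_def card_gt_0_iff)
    note tail = server_tail_bound[OF less_imp_le[OF assms(2)] less_imp_le[OF assms(3)] assms(4,10) d(1)
        less_imp_le[OF assms(5)] lam mu0 mu, folded d(2)]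
    have "\<rho>\<^sub>0 \<le> k u"
      using tail(1) mu0 by (simp add: assms(8) pos_divide_le_eq)
    moreover have "occupancy_bound (real i) \<rho>\<^sub>0 (k u)
        = (lam\<^sub>0 / (k u * \<mu>\<^sub>0)) ^ (dispatcher_degree E d * i) / k u"
    proof -
      have "r_fun \<rho>\<^sub>0 (k u) = (lam\<^sub>0 / (k u * \<mu>\<^sub>0)) ^ dispatcher_degree E d"
        using k_pos rho unfolding r_fun_def d(2)
        by (subst powr_realpow) (auto simp: assms(8) mult.commute intro!: divide_pos_pos mult_pos_pos assms(5) mu0)
      then show ?thesis
        using occupancy_bound_eq[OF rho k_pos, of i] by (simp add: power_mult)
    qed
    ultimately show ?thesis using tail(2)[of i] by simp
  qed
  have alpha: "graph_alpha E = (\<Sum>u\<in>UNIV. (1 / n) *\<^sub>R k u)"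
    by (simp add: graph_alpha_def k_def n_def sum_divide_distrib)
  have "\<rho>\<^sub>0 = (\<Sum>u\<in>(UNIV :: 's set). (1 / n) *\<^sub>R \<rho>\<^sub>0)"
    by (simp add: n_def)
  also have "\<dots> \<le> graph_alpha E"
    unfolding alpha using server n by (intro sum_mono scaleR_left_mono) auto
  finally have alpha_pos: "graph_alpha E > 0" using rho by linarith
  have "r_fun \<rho>\<^sub>0 (graph_alpha E) ^ i / graph_alpha E = occupancy_bound (real i) \<rho>\<^sub>0 (graph_alpha E)"
    by (rule occupancy_bound_eq[OF rho alpha_pos, symmetric])
  also have "\<dots> \<le> (\<Sum>u\<in>UNIV. 1 / n * occupancy_bound (real i) \<rho>\<^sub>0 (k u))"
    unfolding alpha
    by (rule convex_on_sum[OF _ _ occupancy_bound_convex[OF rho]]) (use server n in \<open>auto simp: n_def\<close>)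
  also have "\<dots> \<le> (\<Sum>u\<in>UNIV. 1 / n * measure_pmf.expectation \<pi> (\<lambda>x. of_bool (x u \<ge> i)))"
    using server n by (intro sum_mono mult_left_mono) auto
  also have "\<dots> = measure_pmf.expectation \<pi> (\<lambda>x. occupancy x i)"
  proof -
    have "integrable (measure_pmf \<pi>) (\<lambda>x. of_bool (x u \<ge> i) :: real)" for u
      by (rule integrable_pmf_bounded[where B = 1]) simp
    then show ?thesis
      by (simp add: occupancy_def n_def sum_divide_distrib Bochner_Integration.integral_sum del: sum_of_bool_eq)
  qed
  finally show ?thesis .
qed

end
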